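(* Let $\Phi_\delta^\star:=\min_{V\in\mathcal S}\Phi_\delta(V)$ be the optimal value of the smoothed problem $\min_{V\in\mathcal S}\Phi_\delta(V)$, where $\Phi_\delta(V):=\widetilde f(V)+\rho\big(\|V\|_F^2+\widetilde\psi(V)\big)$ with penalty parameter $\rho>0$. Fix an outer iteration $k\in\mathbb N$. Then, for any $T\in\mathbb N$, the inner iterates $V^{k,l}$ generated by the inner algorithm described in the context satisfy $$\min_{0\le l<T}\mathcal G\big(V^{k,l+1},\Gamma^{k,l}\big)\ \le\ \frac{C}{\sqrt T}\sqrt{\frac{2\big(\Phi_k(V^k)-\Phi_\delta^\star\big)}{L-L_{\widetilde f}}},$$ where $C>0$ is the constant described in the context. In particular, if $$T\ \ge\ \left\lceil\frac{2C^2}{L-L_{\widetilde f}}\cdot\frac{\Phi_k(V^k)-\Phi_\delta^\star}{\epsilon^2}\right\rceil,$$ then the inner loop attains an $\epsilon$-stationary point of $\min_{V\in\mathcal S}\Phi_k(V)$ within $O(\epsilon^{-2})$ iterations, and hence the inner algorithm terminates after finitely many inner iterations.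
   Context: Setting. Let $n,r\ge1$, $p:=n+1$, and let $m$ be an integer in $[2,p]$. Let $A\in\mathbb R^{r\times n}$, $b\in\mathbb R^r$, $\delta>0$, and let $f:\mathbb R^r\to\mathbb R$ be locally Lipschitz continuous (possibly nonsmooth). For a symmetric $p\times p$ matrix $Z=\begin{bmatrix}z_1&z_2^\top\\ z_3&z_4\end{bmatrix}$ with $z_1\in\mathbb R$, $z_2,z_3\in\mathbb R^n$, $z_4\in\mathbb R^{n\times n}$, put $\mathcal A(Z):=\frac12A(z_2+z_3)$. The Moreau envelope is $\mathrm{env}_{\delta f}(x):=\min_{y}\{f(y)+\frac1{2\delta}\|x-y\|^2\}$ (continuously differentiable if $f$ is convex). For vectors $\|\cdot\|$ is the Euclidean norm; for matrices $\|\cdot\|$ is the spectral norm and $\|\cdot\|_F$ the Frobenius norm. Let $\mathcal S:=\{V\in\mathbb R^{m\times p}:\ \|V_j\|=1,\ j=1,\dots,p\}$, with $V_j$ the $j$-th column of $V$. Put $\widetilde f(V):=\mathrm{env}_{\delta f}(\mathcal A(V^\top V)-b)$ and $\widetilde\psi(V):=-\|V^\top V\|$. The gradient $\nabla\widetilde f$ is Lipschitz continuous with constant $L_{\widetilde f}$, and $L\ge L_{\widetilde f}$. $\partial$ denotes the limiting subdifferential and $N_{\mathcal S}$ the limiting normal cone of $\mathcal S$. Inner algorithm. An outer penalty algorithm supplies, at outer iteration $k$, a penalty parameter $\rho_k>0$ and a point $V^k\in\mathcal S$; put $\Phi_k(V):=\widetilde f(V)+\rho_k\big(\|V\|_F^2+\widetilde\psi(V)\big)$.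 Starting from $V^{k,0}:=V^k$, for $l=0,1,2,\dots,l_{\max}$ compute $\Gamma^{k,l}\in\partial\widetilde\psi(V^{k,l})$ (one may take $\Gamma^{k,l}=-2V^{k,l}P_1P_1^\top$ with $P_1$ the leading unit eigenvector of $(V^{k,l})^\top V^{k,l}$) and set $$V^{k,l+1}:=\operatorname{proj}_{\mathcal S}\Big(\tfrac{1}{2\rho_k+L}\big(LV^{k,l}-\nabla\widetilde f(V^{k,l})-\rho_k\Gamma^{k,l}\big)\Big),$$ where $\operatorname{proj}_{\mathcal S}$ normalizes each column to unit length; stop as soon as $\|V^{k,l+1}-V^{k,l}\|_F\le\epsilon_v$, where $\epsilon_v>0$ is a given tolerance. Residual: $\mathcal G(V,\Gamma):=\operatorname{dist}\big(0,\ \nabla\widetilde f(V)+2\rho_kV+\rho_k\Gamma+N_{\mathcal S}(V)\big)$ (Frobenius distance). Constant $C$: $C>0$ denotes the constant of the previously established inequality $\mathcal G(V^{k,l+1},\Gamma^{k,l})\le C\|V^{k,l+1}-V^{k,l}\|_F$ for all $l\in\mathbb N$ (obtained from the optimality condition of the update and the $L_{\widetilde f}$-Lipschitz continuity of $\nabla\widetilde f$, which give $C=L+L_{\widetilde f}$). $\epsilon$-stationarity: given $\epsilon>0$, $V^\star\in\mathcal S$ is an $\epsilon$-stationary point of $\min_{V\in\mathcal S}\Phi_k(V)$ if there exists $\Gamma^\star\in\partial\widetilde\psi(U)$ for some $U\in\mathcal S$ with $\|U-V^\star\|_F\le\epsilon$ such that $\mathcal G(V^\star,\Gamma^\star)\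le\epsilon$.
   Formalization: Assumes L > L_f (the bound divides by L − L_f) and ρ ≤ ρ_k (else the root may be undefined); with the stated threshold on T, ε-stationarity is claimed only when C ≥ 1 (it can fail for C < 1; C may be enlarged to 1), while the O(ε^-2) and termination claims hold for all C. *)

theory Defs
  imports "HOL-Analysis.Analysis" "HOL-Library.Landau_Symbols"
begin

text \<open>
  Matrices with \<open>m\<close> rows and \<open>p = n + 1\<close> columns have type \<open>real^('n option)^'m\<close>: the index
  \<open>None\<close> plays the role of the distinguished first index, \<open>Some i\<close> that of the other \<open>n\<close> indices.
  On this type \<open>norm\<close> is the Frobenius norm and \<open>inner\<close> the trace inner product; the spectral norm
  of \<open>M\<close> is \<open>onorm ((*v) M)\<close>.
\<close>

definition moreau_env :: "real \<Rightarrow> ('a::real_normed_vector \<Rightarrow> real) \<Rightarrow> 'a \<Rightarrow> real" where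
  "moreau_env \<delta> f x = (INF y. f y + (norm (x - y))\<^sup>2 / (2 * \<delta>))"

text \<open>\<open>\<nabla>F\<close>; only meaningful at points where \<open>F\<close> is differentiable.\<close>
definition grad :: "('a::real_inner \<Rightarrow> real) \<Rightarrow> 'a \<Rightarrow> 'a" where
  "grad F x = (THE D. GDERIV F x :> D)"

definition frechet_subdiff :: "('a::real_inner \<Rightarrow> real) \<Rightarrow> 'a \<Rightarrow> 'a set" where
  "frechet_subdiff \<phi> x =
     {v. \<forall>e>0. \<forall>\<^sub>F y in at x. \<phi> y \<ge> \<phi> x + v \<bullet> (y - x) - e * norm (y - x)}"

definition limiting_subdiff :: "('a::real_inner \<Rightarrow> real) \<Rightarrow> 'a \<Rightarrow> 'a set" where
  "limiting_subdiff \<phi> x =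
     {v. \<exists>xs vs. xs \<longlonglongrightarrow> x \<and> (\<lambda>k. \<phi> (xs k)) \<longlonglongrightarrow> \<phi> x \<and>
           (\<forall>k. vs k \<in> frechet_subdiff \<phi> (xs k)) \<and> vs \<longlonglongrightarrow> v}"

definition frechet_normal_cone :: "'a::real_inner set \<Rightarrow> 'a \<Rightarrow> 'a set" where
  "frechet_normal_cone S x =
     {v. x \<in> S \<and> (\<forall>e>0. \<forall>\<^sub>F y in at x within S. v \<bullet> (y - x) \<le> e * norm (y - x))}"

definition limiting_normal_cone :: "'a::real_inner set \<Rightarrow> 'a \<Rightarrow> 'a set" where
  "limiting_normal_cone S x =
     {v. x \<in> S \<and> (\<exists>xs vs. xs \<longlonglongrightarrow> x \<and> (\<forall>k. vs k \<in> frechet_normal_cone S (xs k)) \<and> vs \<longlonglongrightarrow> v)}"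

definition unit_columns :: "(real^'p^'m) set" where
  "unit_columns = {V. \<forall>j. norm (column j V) = 1}"

text \<open>
  The (set-valued) metric projection.  For \<open>unit_columns\<close> it normalizes each column, a zero column
  being sent to an arbitrary unit vector; see lemma \<open>proj_unit_columns\<close>.
\<close>
definition proj_set :: "'a::metric_space set \<Rightarrow> 'a \<Rightarrow> 'a set" where
  "proj_set S W = {V \<in> S. \<forall>U\<in>S. dist W V \<le> dist W U}"

text \<open>\<open>\<A>(Z) = A (z\<^sub>2 + z\<^sub>3) / 2\<close>.\<close>
definition lin_op :: "real^'n^'r \<Rightarrow> real^('n option)^('n option) \<Rightarrow> real^'r" where
  "lin_op A Z = (1/2) *\<^sub>R (A *v ((\<chi> i. Z $ None $ Some i) + (\<chi> i. Z $ Some i $ None)))"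

definition f_tilde ::
    "real^'n^'r \<Rightarrow> real^'r \<Rightarrow> real \<Rightarrow> (real^'r \<Rightarrow> real) \<Rightarrow> real^('n option)^'m \<Rightarrow> real" where
  "f_tilde A b \<delta> f V = moreau_env \<delta> f (lin_op A (transpose V ** V) - b)"

definition psi_tilde :: "real^'p^'m \<Rightarrow> real" where
  "psi_tilde V = - onorm ((*v) (transpose V ** V))"

text \<open>In the following definitions \<open>F\<close> stands for the smooth part \<open>f_tilde A b \<delta> f\<close>.\<close>

definition penalized :: "(real^'p^'m \<Rightarrow> real) \<Rightarrow> real \<Rightarrow> real^'p^'m \<Rightarrow> real" where
  "penalized F \<rho> V = F V + \<rho> * ((norm V)\<^sup>2 + psi_tilde V)"

definition residual ::
    "(real^'p^'m \<Rightarrow> real) \<Rightarrow> real \<Rightarrow> real^'p^'m \<Rightarrow> real^'p^'m \<Rightarrow> real" where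
  "residual F \<rho> V \<Gamma> =
     infdist 0 ((\<lambda>\<nu>. grad F V + (2 * \<rho>) *\<^sub>R V + \<rho> *\<^sub>R \<Gamma> + \<nu>) ` limiting_normal_cone unit_columns V)"

definition eps_stationary ::
    "(real^'p^'m \<Rightarrow> real) \<Rightarrow> real \<Rightarrow> real \<Rightarrow> real^'p^'m \<Rightarrow> bool" where
  "eps_stationary F \<rho> \<epsilon> V \<longleftrightarrow> V \<in> unit_columns \<and>
     (\<exists>U\<in>unit_columns. norm (U - V) \<le> \<epsilon> \<and>
        (\<exists>\<Gamma>\<in>limiting_subdiff psi_tilde U. residual F \<rho> V \<Gamma> \<le> \<epsilon>))"

text \<open>
  The iteration without its stopping test: a run that stops is an initial segment of such a
  sequence.
\<close>
definition inner_iterates ::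
    "(real^'p^'m \<Rightarrow> real) \<Rightarrow> real \<Rightarrow> real \<Rightarrow> real^'p^'m \<Rightarrow>
     (nat \<Rightarrow> real^'p^'m) \<Rightarrow> (nat \<Rightarrow> real^'p^'m) \<Rightarrow> bool" where
  "inner_iterates F \<rho> L V0 V \<Gamma> \<longleftrightarrow> V 0 = V0 \<and>
     (\<forall>l. \<Gamma> l \<in> limiting_subdiff psi_tilde (V l) \<and>
          V (Suc l) \<in> proj_set unit_columns
            ((1 / (2 * \<rho> + L)) *\<^sub>R (L *\<^sub>R V l - grad F (V l) - \<rho> *\<^sub>R \<Gamma> l)))"

lemma norm_sq_columns: "(norm (V :: real^'p^'m))\<^sup>2 = (\<Sum>j\<in>UNIV. (norm (column j V))\<^sup>2)"
proof -
  have "(norm V)\<^sup>2 = (\<Sum>i\<in>UNIV. \<Sum>j\<in>UNIV. (V $ i $ j)\<^sup>2)"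
    unfolding power2_norm_eq_inner inner_vec_def by (simp add: power2_eq_square)
  also have "\<dots> = (\<Sum>j\<in>UNIV. \<Sum>i\<in>UNIV. (V $ i $ j)\<^sup>2)"
    by (rule sum.swap)
  also have "\<dots> = (\<Sum>j\<in>UNIV. (norm (column j V))\<^sup>2)"
    unfolding power2_norm_eq_inner inner_vec_def by (simp add: power2_eq_square column_def)
  finally show ?thesis .
qed

lemma proj_unit_columns:
  fixes V W :: "real^'p^'m"
  shows "V \<in> proj_set unit_columns W \<longleftrightarrow>
    (\<forall>j. norm (column j V) = 1 \<and> column j W = norm (column j W) *\<^sub>R column j V)"
proof -
  have dist_sq: "(dist W V)\<^sup>2 = (\<Sum>j\<in>UNIV. (norm (column j W))\<^sup>2 + 1 - 2 * (column j W \<bullet> column j V))"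
    if "V \<in> unit_columns" for V :: "real^'p^'m"
  proof -
    have c: "column j (W - V) = column j W - column j V" for j
      by (simp add: column_def vec_eq_iff)
    have "(norm (column j W - column j V))\<^sup>2
        = (norm (column j W))\<^sup>2 + 1 - 2 * (column j W \<bullet> column j V)" for j
      using that by (simp add: unit_columns_def power2_norm_eq_inner inner_diff_left
        inner_diff_right inner_commute norm_eq_1)
    then show ?thesis by (simp add: dist_norm norm_sq_columns c)
  qed
  have cs: "column j W \<bullet> column j U \<le> norm (column j W)" if "U \<in> unit_columns" for j and U :: "real^'p^'m"
    using that norm_cauchy_schwarz[of "column j W" "column j U"] by (simp add: unit_columns_def)
  have eq: "column j W = norm (column j W) *\<^sub>R column j V \<longleftrightarrow>
      column j W \<bullet> column j V = norm (column j W)" if "V \<in> unit_columns" for j and V :: "real^'p^'m"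
    using that norm_cauchy_schwarz_eq[of "column j W" "column j V"]
    by (auto simp: unit_columns_def)
  obtain e :: "real^'m" where e: "norm e = 1" using vector_choose_size[of 1] by auto
  define N :: "real^'p^'m" where
    "N = (\<chi> i j. (if column j W = 0 then e else (1 / norm (column j W)) *\<^sub>R column j W) $ i)"
  have colN: "column j N = (if column j W = 0 then e else (1 / norm (column j W)) *\<^sub>R column j W)" for j
    by (simp add: N_def column_def vec_eq_iff)
  have NS: "N \<in> unit_columns" by (auto simp: unit_columns_def colN e)
  have "column j W = norm (column j W) *\<^sub>R column j N" for j by (auto simp: colN)
  then have Neq: "column j W \<bullet> column j N = norm (column j W)" for j using eq[OF NS] by blast
  show ?thesis
  proof
    assume V: "V \<in> proj_set unit_columns W"
    then have VS: "V \<in> unit_columns" and "dist W V \<le> dist W N"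
      using NS by (auto simp: proj_set_def)
    then have "(dist W V)\<^sup>2 \<le> (dist W N)\<^sup>2" by (simp add: power_mono)
    then have "(\<Sum>j\<in>UNIV. norm (column j W)) \<le> (\<Sum>j\<in>UNIV. column j W \<bullet> column j V)"
      by (simp add: dist_sq VS NS Neq sum_subtractf sum_distrib_left[symmetric])
    then have "(\<Sum>j\<in>UNIV. norm (column j W) - column j W \<bullet> column j V) = 0"
      using sum_mono[of UNIV "\<lambda>j. column j W \<bullet> column j V" "\<lambda>j. norm (column j W)"] cs[OF VS]
      by (simp add: sum_subtractf)
    then have "\<forall>j. column j W \<bullet> column j V = norm (column j W)"
      using cs[OF VS]
        sum_nonneg_eq_0_iff[of UNIV "\<lambda>j. norm (column j W) - column j W \<bullet> column j V"]
      by simp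
    then show "\<forall>j. norm (column j V) = 1 \<and> column j W = norm (column j W) *\<^sub>R column j V"
      using eq[OF VS] VS by (auto simp: unit_columns_def)
  next
    assume *: "\<forall>j. norm (column j V) = 1 \<and> column j W = norm (column j W) *\<^sub>R column j V"
    then have VS: "V \<in> unit_columns" by (simp add: unit_columns_def)
    then have Veq: "column j W \<bullet> column j V = norm (column j W)" for j using eq[OF VS] * by blast
    have "dist W V \<le> dist W U" if U: "U \<in> unit_columns" for U
    proof (rule power2_le_imp_le)
      show "(dist W V)\<^sup>2 \<le> (dist W U)\<^sup>2"
        unfolding dist_sq[OF VS] dist_sq[OF U] Veq
        by (intro sum_mono) (use cs[OF U] in simp)
    qed simp
    then show "V \<in> proj_set unit_columns W" using VS by (simp add: proj_set_def)
  qed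
qed

end

theory Submission
  imports Defs
begin

text \<open>
  Since \<open>-\<psi>\<close> is the squared largest singular value it is convex, so every limiting subgradient of
  \<open>\<psi>\<close> is a supergradient and \<open>\<psi>\<close> lies below its linearizations.  All points of the constraint set
  have the same Frobenius norm; hence optimality of the projection and the descent lemma for \<open>F\<close>
  give \<open>\<Phi>(V\<^sub>l\<^sub>+\<^sub>1) \<le> \<Phi>(V\<^sub>l) - (L - L\<^sub>f)/2 \<parallel>V\<^sub>l\<^sub>+\<^sub>1 - V\<^sub>l\<parallel>\<^sup>2\<close>.  Telescoping bounds the smallest step.  The
  vector from the projection to the projected point is a proximal normal, which bounds the residual
  by the step.  Lowering the penalty parameter lowers \<open>\<Phi>\<close> because \<open>\<parallel>V\<^sup>TV\<parallel> \<le> \<parallel>V\<parallel>\<^sub>F\<^sup>2\<close>.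
\<close>

subsection \<open>Gradients and subgradients\<close>

text \<open>\<open>grad\<close> is a definite description, so it means something only once existence
  and uniqueness are known. Existence is Riesz representation in the standard basis; uniqueness is
  that of the Frechet derivative.\<close>

lemma GDERIV_grad:
  fixes F :: "'a::euclidean_space \<Rightarrow> real"
  assumes "F differentiable (at x)"
  shows "GDERIV F x :> grad F x"
proof -
  obtain F' where F': "(F has_derivative F') (at x)"
    using assms by (auto simp: differentiable_def)
  then interpret linear F' by (rule has_derivative_linear)
  define D where "D = (\<Sum>i\<in>Basis. F' i *\<^sub>R i)"
  have "F' h = h \<bullet> D" for h
  proof -
    have "F' h = F' (\<Sum>i\<in>Basis. (h \<bullet> i) *\<^sub>R i)" by (simp add: euclidean_representation)
    also have "\<dots> = h \<bullet> D" by (simp add: sum scale D_def inner_sum_right mult.commute)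
    finally show ?thesis .
  qed
  then have "F' = (\<lambda>h. h \<bullet> D)" by auto
  then have D: "GDERIV F x :> D" using F' by (simp add: gderiv_def)
  have "D' = D" if "GDERIV F x :> D'" for D'
  proof -
    have "(\<lambda>h. h \<bullet> D') = (\<lambda>h. h \<bullet> D)"
      using that D unfolding gderiv_def by (rule has_derivative_unique)
    then show ?thesis by (simp add: fun_eq_iff vector_eq_ldot)
  qed
  then show ?thesis unfolding grad_def using D by (metis theI)
qed

text \<open>Along the segment from \<open>x\<close> to \<open>y\<close>, the difference
  \<open>g\<close> between \<open>F\<close> and its quadratic upper model has nonpositive
  derivative, by Cauchy-Schwarz and the Lipschitz bound. Only points of the segment enter, so a
  convex domain suffices.\<close>

lemma descent_lemma:
  fixes F :: "'a::euclidean_space \<Rightarrow> real"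
  assumes S: "convex S" and diff: "\<And>u. u \<in> S \<Longrightarrow> F differentiable (at u)"
    and lip: "K-lipschitz_on S (grad F)" and x: "x \<in> S" and y: "y \<in> S"
  shows "F y \<le> F x + grad F x \<bullet> (y - x) + K / 2 * (norm (y - x))\<^sup>2"
proof -
  define d where "d = y - x"
  define g where "g t = F (x + t *\<^sub>R d) - t * (grad F x \<bullet> d) - K / 2 * t\<^sup>2 * (norm d)\<^sup>2" for t
  have seg: "x + t *\<^sub>R d \<in> S" if "0 \<le> t" "t \<le> 1" for t
  proof -
    have "x + t *\<^sub>R d = (1 - t) *\<^sub>R x + t *\<^sub>R y" by (simp add: d_def algebra_simps)
    then show ?thesis using convexD[OF S x y, of "1 - t" t] that by simp
  qed
  have "g 1 \<le> g 0"
  proof (rule DERIV_nonpos_imp_nonincreasing[of 0 1 g])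
    fix t :: real assume t: "0 \<le> t" "t \<le> 1"
    have "(F has_derivative (\<lambda>h. h \<bullet> grad F (x + t *\<^sub>R d))) (at (x + t *\<^sub>R d))"
      using GDERIV_grad[OF diff[OF seg[OF t]]] by (simp add: gderiv_def)
    then have "((\<lambda>t. F (x + t *\<^sub>R d)) has_derivative (\<lambda>h. (h *\<^sub>R d) \<bullet> grad F (x + t *\<^sub>R d))) (at t)"
      by (rule has_derivative_compose[rotated]) (auto intro!: derivative_eq_intros)
    then have DF: "((\<lambda>t. F (x + t *\<^sub>R d)) has_real_derivative d \<bullet> grad F (x + t *\<^sub>R d)) (at t)"
      by (rule has_derivative_imp_has_field_derivative) simp
    have "(g has_real_derivative
        d \<bullet> grad F (x + t *\<^sub>R d) - grad F x \<bullet> d - K * t * (norm d)\<^sup>2) (at t)"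
      unfolding g_def
      by (rule DERIV_diff[OF DERIV_diff[OF DF]]) (auto intro!: derivative_eq_intros)
    moreover have "d \<bullet> grad F (x + t *\<^sub>R d) - grad F x \<bullet> d - K * t * (norm d)\<^sup>2 \<le> 0"
    proof -
      have "d \<bullet> grad F (x + t *\<^sub>R d) - grad F x \<bullet> d = d \<bullet> (grad F (x + t *\<^sub>R d) - grad F x)"
        by (simp add: inner_diff_right inner_commute)
      also have "\<dots> \<le> norm d * norm (grad F (x + t *\<^sub>R d) - grad F x)"
        by (rule norm_cauchy_schwarz)
      also have "\<dots> \<le> norm d * (K * norm (t *\<^sub>R d))"
        using lipschitz_onD[OF lip seg[OF t] x] by (intro mult_left_mono) (auto simp: dist_norm)
      also have "\<dots> = K * t * (norm d)\<^sup>2" using t by (simp add: power2_eq_square)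
      finally show ?thesis by simp
    qed
    ultimately show "\<exists>y. (g has_real_derivative y) (at t) \<and> y \<le> 0" by blast
  qed simp
  then show ?thesis by (simp add: g_def d_def)
qed

text \<open>A lower bound near \<open>x\<close> on one side limits how steeply a concave function
  can rise on the other side, which makes the local first-order condition a global upper
  bound.\<close>

lemma frechet_subdiff_concave:
  assumes conc: "concave_on UNIV \<phi>" and v: "v \<in> frechet_subdiff \<phi> x"
  shows "\<phi> y \<le> \<phi> x + v \<bullet> (y - x)"
proof (cases "y = x")
  case False
  define d where "d = y - x"
  have d0: "norm d > 0" using False by (simp add: d_def)
  show ?thesis
  proof (rule field_le_epsilon)
    fix e :: real assume e: "e > 0"
    \<comment> \<open>With tolerance \<open>e / norm d\<close> the error at \<open>x - t d\<close>
      is \<open>e * t\<close>, so that \<open>e\<close> remains after division by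
      \<open>t\<close>.\<close>
    have "\<forall>\<^sub>F z in at x. \<phi> z \<ge> \<phi> x + v \<bullet> (z - x) - (e / norm d) * norm (z - x)"
      using v divide_pos_pos[OF e d0] unfolding frechet_subdiff_def by blast
    then obtain r where r: "r > 0"
      "\<And>z. z \<noteq> x \<Longrightarrow> dist z x < r \<Longrightarrow> \<phi> z \<ge> \<phi> x + v \<bullet> (z - x) - (e / norm d) * norm (z - x)"
      by (auto simp: eventually_at)
    define t where "t = r / (2 * norm d)"
    have t0: "t > 0" using r d0 by (simp add: t_def)
    txt \<open>Concavity on the segment from the reflected point \<open>x - t d\<close> through \<open>x\<close> to \<open>y = x + d\<close>
      turns the lower bound at \<open>x - t d\<close> into an upper bound at \<open>y\<close>.\<close>
    have low: "\<phi> (x - t *\<^sub>R d) \<ge> \<phi> x - t * (v \<bullet> d) - e * t"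
      using r(2)[of "x - t *\<^sub>R d"] t0 d0 r(1) by (simp add: dist_norm t_def)
    \<comment> \<open>This weight solves \<open>(1 - s) * t = s\<close>, which makes
      \<open>x\<close> the convex combination of \<open>x - t d\<close> and
      \<open>y\<close>.\<close>
    define s where "s = t / (1 + t)"
    have s: "0 \<le> s" "s \<le> 1" "1 - s = 1 / (1 + t)" using t0 by (auto simp: s_def field_simps)
    have "x = (1 - s) *\<^sub>R (x - t *\<^sub>R d) + s *\<^sub>R y"
    proof -
      have "(1 - s) * t = s" using s t0 by (simp add: s_def)
      then have "((1 - s) * t) *\<^sub>R d = s *\<^sub>R d" by simp
      then show ?thesis unfolding scaleR_diff_right scaleR_scaleR
        by (simp add: d_def algebra_simps)
    qed
    then have "(1 - s) * \<phi> (x - t *\<^sub>R d) + s * \<phi> y \<le> \<phi> x"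
      using concave_onD[OF conc s(1,2), of "x - t *\<^sub>R d" y] by simp
    moreover have "(1 - s) * \<phi> (x - t *\<^sub>R d) + s * \<phi> y = (\<phi> (x - t *\<^sub>R d) + t * \<phi> y) / (1 + t)"
      unfolding s(3) by (simp add: s_def add_divide_distrib)
    ultimately have "\<phi> (x - t *\<^sub>R d) + t * \<phi> y \<le> (1 + t) * \<phi> x"
      using t0 by (simp add: pos_divide_le_eq mult.commute)
    with low have "t * \<phi> y \<le> t * (\<phi> x + v \<bullet> d + e)" by (simp add: algebra_simps)
    then show "\<phi> y \<le> \<phi> x + v \<bullet> (y - x) + e" using t0 by (simp add: d_def)
  qed
qed simp

text \<open>For fixed \<open>y\<close> the supergradient inequality is closed under joint limits of
  the base point, its function value and the subgradient.\<close>

lemma limiting_subdiff_concave: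
  assumes conc: "concave_on UNIV \<phi>" and v: "v \<in> limiting_subdiff \<phi> x"
  shows "\<phi> y \<le> \<phi> x + v \<bullet> (y - x)"
proof -
  obtain xs vs where "xs \<longlonglongrightarrow> x" "(\<lambda>k. \<phi> (xs k)) \<longlonglongrightarrow> \<phi> x" "vs \<longlonglongrightarrow> v"
    and fs: "\<And>k. vs k \<in> frechet_subdiff \<phi> (xs k)"
    using v by (auto simp: limiting_subdiff_def)
  then have "(\<lambda>k. \<phi> (xs k) + vs k \<bullet> (y - xs k)) \<longlonglongrightarrow> \<phi> x + v \<bullet> (y - x)"
    by (intro tendsto_intros)
  then show ?thesis
    by (rule LIMSEQ_le_const) (use frechet_subdiff_concave[OF conc fs] in blast)
qed

text \<open>Expanding the minimal-distance inequality bounds the inner product with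
  \<open>W - P\<close> by a quadratic in \<open>y - P\<close>, which is of smaller order than
  \<open>norm (y - P)\<close>. Convexity of \<open>S\<close> is not assumed; constant sequences pass
  from the Frechet to the limiting cone.\<close>

lemma proj_set_normal:
  fixes P W :: "'a::real_inner"
  assumes P: "P \<in> proj_set S W" and c: "c \<ge> 0"
  shows "c *\<^sub>R (W - P) \<in> limiting_normal_cone S P"
proof -
  have PS: "P \<in> S" using P by (simp add: proj_set_def)
  have quad: "(W - P) \<bullet> (y - P) \<le> (norm (y - P))\<^sup>2 / 2" if "y \<in> S" for y
  proof -
    have "(norm (W - P))\<^sup>2 \<le> (norm (W - y))\<^sup>2"
      using P that by (simp add: proj_set_def dist_norm power_mono)
    also have "W - y = (W - P) - (y - P)" by simp
    also have "(norm \<dots>)\<^sup>2 = (norm (W - P))\<^sup>2 - 2 * ((W - P) \<bullet> (y - P)) + (norm (y - P))\<^sup>2"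
      by (simp add: power2_norm_eq_inner inner_diff_left inner_diff_right inner_commute)
    finally show ?thesis by simp
  qed
  have "\<forall>\<^sub>F y in at P within S. (c *\<^sub>R (W - P)) \<bullet> (y - P) \<le> e * norm (y - P)" if e: "e > 0" for e
    unfolding eventually_at
  proof (intro exI conjI ballI impI)
    \<comment> \<open>Within this radius \<open>c * norm (y - P) / 2\<close> is at most
      \<open>e\<close>; the added 1 keeps the denominator positive when
      \<open>c = 0\<close>.\<close>
    show "2 * e / (c + 1) > 0" using e c by simp
    fix y assume y: "y \<in> S" "y \<noteq> P \<and> dist y P < 2 * e / (c + 1)"
    have "(c + 1) * norm (y - P) < 2 * e" using y c by (simp add: dist_norm field_simps)
    then have "c * norm (y - P) \<le> 2 * e"
      using norm_ge_zero[of "y - P"] unfolding distrib_right by linarith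
    then have "c * norm (y - P) * norm (y - P) \<le> 2 * e * norm (y - P)"
      by (rule mult_right_mono) simp
    moreover have "c * ((W - P) \<bullet> (y - P)) \<le> c * ((norm (y - P))\<^sup>2 / 2)"
      using quad[OF y(1)] c by (rule mult_left_mono)
    ultimately show "(c *\<^sub>R (W - P)) \<bullet> (y - P) \<le> e * norm (y - P)"
      by (simp add: power2_eq_square)
  qed
  then have "c *\<^sub>R (W - P) \<in> frechet_normal_cone S P"
    using PS by (simp add: frechet_normal_cone_def)
  then show ?thesis unfolding limiting_normal_cone_def using PS
    by (intro CollectI conjI exI[of _ "\<lambda>_. P"] exI[of _ "\<lambda>_. c *\<^sub>R (W - P)"] allI tendsto_const)
qed

subsection \<open>The spectral term\<close>

text \<open>Cauchy-Schwarz row by row; it places the spectral norm below the Frobenius norm.\<close>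

lemma norm_matrix_vector_mult_le: "norm (M *v x) \<le> norm M * norm (x :: real^'p)"
  for M :: "real^'p^'m"
proof (rule power2_le_imp_le)
  have "(norm (M *v x))\<^sup>2 = (\<Sum>i\<in>UNIV. (M $ i \<bullet> x)\<^sup>2)"
    unfolding power2_norm_eq_inner inner_vec_def[of "M *v x"]
    by (simp add: matrix_vector_mul_component power2_eq_square)
  also have "\<dots> \<le> (\<Sum>i\<in>UNIV. (norm (M $ i))\<^sup>2 * (norm x)\<^sup>2)"
    by (intro sum_mono) (metis Cauchy_Schwarz_ineq power2_norm_eq_inner)
  also have "\<dots> = (\<Sum>i\<in>UNIV. (norm (M $ i))\<^sup>2) * (norm x)\<^sup>2"
    by (simp add: sum_distrib_right)
  also have "(\<Sum>i\<in>UNIV. (norm (M $ i))\<^sup>2) = (norm M)\<^sup>2"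
    unfolding power2_norm_eq_inner inner_vec_def[of M] ..
  finally show "(norm (M *v x))\<^sup>2 \<le> (norm M * norm x)\<^sup>2" by (simp add: power_mult_distrib)
qed simp

text \<open>The identity expressing the spectral norm of a Gram matrix through the largest singular
  value. Both bounds come from moving \<open>V\<close> across the inner product.\<close>

lemma onorm_gram: "onorm ((*v) (transpose V ** V)) = (onorm ((*v) V))\<^sup>2"
  for V :: "real^'p^'m"
proof (rule antisym)
  have bl: "bounded_linear ((*v) M)" for M :: "real^'a^'b"
    by (simp add: matrix_vector_mul_bounded_linear)
  let ?s = "onorm ((*v) V)" and ?h = "onorm ((*v) (transpose V ** V))"
  have s0: "?s \<ge> 0" and h0: "?h \<ge> 0" using onorm_pos_le bl by blast+
  have gram: "x \<bullet> ((transpose V ** V) *v y) = (V *v x) \<bullet> (V *v y)" for x y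
    by (metis dot_lmul_matrix matrix_vector_mul_assoc vector_transpose_matrix)
  show "?h \<le> ?s\<^sup>2"
  proof (rule onorm_bound)
    fix x :: "real^'p"
    let ?y = "(transpose V ** V) *v x"
    \<comment> \<open>Pairing \<open>?y\<close> with itself turns the transpose into a second
      application of \<open>V\<close>, so only the operator norm of \<open>V\<close> occurs.\<close>
    have "norm ?y * norm ?y = (V *v ?y) \<bullet> (V *v x)"
      by (metis gram power2_eq_square power2_norm_eq_inner)
    also have "\<dots> \<le> norm (V *v ?y) * norm (V *v x)" by (rule norm_cauchy_schwarz)
    also have "\<dots> \<le> (?s * norm ?y) * (?s * norm x)"
      using onorm[OF bl[of V]] s0 by (intro mult_mono) auto
    finally have "norm ?y * norm ?y \<le> norm ?y * (?s\<^sup>2 * norm x)"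
      by (simp add: power2_eq_square mult_ac)
    then show "norm ?y \<le> ?s\<^sup>2 * norm x"
      by (cases "norm ?y = 0") (simp_all add: mult_le_cancel_left)
  qed simp
  have "?s \<le> sqrt ?h"
  proof (rule onorm_bound)
    fix x :: "real^'p"
    have "(norm (V *v x))\<^sup>2 = x \<bullet> ((transpose V ** V) *v x)"
      by (simp add: gram power2_norm_eq_inner)
    also have "\<dots> \<le> norm x * norm ((transpose V ** V) *v x)" by (rule norm_cauchy_schwarz)
    also have "\<dots> \<le> norm x * (?h * norm x)"
      using onorm[OF bl[of "transpose V ** V"]] by (intro mult_left_mono) auto
    also have "\<dots> = (sqrt ?h * norm x)\<^sup>2" using h0 by (simp add: power_mult_distrib power2_eq_square)
    finally show "norm (V *v x) \<le> sqrt ?h * norm x"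
      by (rule power2_le_imp_le) (simp add: h0)
  qed (simp add: h0)
  then show "?s\<^sup>2 \<le> ?h" using power_mono[OF _ s0, of "sqrt ?h" 2] h0 by simp
qed

lemma psi_tilde_eq: "psi_tilde V = - (onorm ((*v) V))\<^sup>2"
  by (simp add: psi_tilde_def onorm_gram)

text \<open>This makes the penalty term nonnegative, hence \<open>penalized\<close> monotone in the
  penalty parameter.\<close>

lemma psi_tilde_ge: "psi_tilde V \<ge> - (norm V)\<^sup>2"
proof -
  have "onorm ((*v) V) \<le> norm V"
    by (rule onorm_bound) (auto intro: norm_matrix_vector_mult_le)
  then show ?thesis
    by (simp add: psi_tilde_eq power_mono onorm_pos_le matrix_vector_mul_bounded_linear)
qed

text \<open>The negative of \<open>psi_tilde\<close> is the square of a norm: the triangle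
  inequality, then convexity of the square on nonnegative reals.\<close>

lemma concave_psi_tilde: "concave_on UNIV (psi_tilde :: real^'p^'m \<Rightarrow> real)"
  unfolding concave_on_iff
proof (intro conjI ballI allI impI)
  fix X Y :: "real^'p^'m" and u v :: real
  assume uv: "0 \<le> u" "0 \<le> v" "u + v = 1"
  let ?n = "\<lambda>M :: real^'p^'m. onorm ((*v) M)"
  have bl: "bounded_linear ((*v) M)" for M :: "real^'p^'m"
    by (simp add: matrix_vector_mul_bounded_linear)
  have n0: "?n M \<ge> 0" for M using onorm_pos_le bl by blast
  have "(*v) (u *\<^sub>R X + v *\<^sub>R Y) = (\<lambda>z. u *\<^sub>R (X *v z) + v *\<^sub>R (Y *v z))"
    by (auto simp: matrix_vector_mult_add_rdistrib scaleR_matrix_vector_assoc)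
  then have "?n (u *\<^sub>R X + v *\<^sub>R Y) \<le> u * ?n X + v * ?n Y"
    using onorm_triangle[of "\<lambda>z. u *\<^sub>R (X *v z)" "\<lambda>z. v *\<^sub>R (Y *v z)"]
    by (simp add: onorm_scaleR bl bounded_linear_const_scaleR uv)
  then have "(?n (u *\<^sub>R X + v *\<^sub>R Y))\<^sup>2 \<le> (u * ?n X + v * ?n Y)\<^sup>2"
    by (rule power_mono) (rule n0)
  also have "\<dots> \<le> u * (?n X)\<^sup>2 + v * (?n Y)\<^sup>2"
  proof -
    \<comment> \<open>The Jensen defect of the square for two weights summing to 1.\<close>
    have "u * a\<^sup>2 + v * c\<^sup>2 - (u * a + v * c)\<^sup>2 = u * v * (a - c)\<^sup>2" for a c
    proof -
      have v: "v = 1 - u" using uv by simp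
      show ?thesis unfolding v by (simp add: power2_eq_square algebra_simps)
    qed
    moreover have "u * v * (?n X - ?n Y)\<^sup>2 \<ge> 0" using uv by simp
    ultimately show ?thesis by (metis diff_ge_0_iff_ge)
  qed
  finally show "u * psi_tilde X + v * psi_tilde Y \<le> psi_tilde (u *\<^sub>R X + v *\<^sub>R Y)"
    by (simp add: psi_tilde_eq)
qed simp

subsection \<open>The feasible set\<close>

text \<open>The feasible set lies on a sphere, so quadratic terms cancel whenever two feasible
  points are compared.\<close>

lemma norm_sq_unit_columns: "V \<in> unit_columns \<Longrightarrow> (norm V)\<^sup>2 = real CARD('p)"
  for V :: "real^'p^'m"
  by (simp add: norm_sq_columns unit_columns_def)

lemma compact_unit_columns: "compact (unit_columns :: (real^'p^'m) set)"
proof -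
  have "closed (unit_columns :: (real^'p^'m) set)"
    unfolding unit_columns_def column_def
    by (intro closed_Collect_all closed_Collect_eq continuous_intros)
  moreover have "bounded (unit_columns :: (real^'p^'m) set)"
    by (rule boundedI[where B = "sqrt (real CARD('p))"])
      (auto intro: real_le_rsqrt simp: norm_sq_unit_columns)
  ultimately show ?thesis by (simp add: compact_eq_bounded_closed)
qed

text \<open>Links the optimal value at a smaller penalty parameter to function values at a larger
  one, using nonnegativity of the penalty.\<close>

lemma INF_penalized_le:
  fixes F :: "real^'p^'m \<Rightarrow> real"
  assumes cont: "continuous_on unit_columns F" and \<rho>: "0 \<le> \<rho>" "\<rho> \<le> \<rho>'" and V: "V \<in> unit_columns"
  shows "(INF U\<in>unit_columns. penalized F \<rho> U) \<le> penalized F \<rho>' V"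
proof -
  have ge: "(norm U)\<^sup>2 + psi_tilde U \<ge> 0" for U :: "real^'p^'m"
    using psi_tilde_ge[of U] by simp
  obtain B where B: "\<And>U. U \<in> unit_columns \<Longrightarrow> F B \<le> F U"
    using continuous_attains_inf[OF compact_unit_columns _ cont] V by blast
  \<comment> \<open>A real \<open>INF\<close> is a genuine lower bound only for sets bounded below;
    here the minimum of \<open>F\<close> on the compact feasible set serves as bound.\<close>
  have "bdd_below (penalized F \<rho> ` unit_columns)"
  proof (rule bdd_belowI2)
    fix U :: "real^'p^'m" assume "U \<in> unit_columns"
    then show "F B \<le> penalized F \<rho> U"
      using B[of U] mult_nonneg_nonneg[OF \<rho>(1) ge[of U]] unfolding penalized_def by linarith
  qed
  then have "(INF U\<in>unit_columns. penalized F \<rho> U) \<le> penalized F \<rho> V"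
    using V by (rule cINF_lower)
  also have "\<dots> \<le> penalized F \<rho>' V"
    unfolding penalized_def using \<rho>(2) ge[of V] by (simp add: mult_right_mono)
  finally show ?thesis .
qed

subsection \<open>The iteration\<close>

text \<open>Smoothness is required on the convex hull because the descent lemma runs along segments
  between iterates, which may leave the feasible set.\<close>

locale inner_run =
  fixes F :: "real^'p^'m \<Rightarrow> real" and \<rho> L L\<^sub>f :: real and V0 and V \<Gamma> :: "nat \<Rightarrow> real^'p^'m"
  assumes diff: "\<And>U. U \<in> convex hull unit_columns \<Longrightarrow> F differentiable (at U)"
    and smooth: "L\<^sub>f-lipschitz_on (convex hull unit_columns) (grad F)"
    and L: "L\<^sub>f < L" and \<rho>: "0 < \<rho>" and V0: "V0 \<in> unit_columns"
    and iter: "inner_iterates F \<rho> L V0 V \<Gamma>"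
begin

abbreviation "W l \<equiv> (1 / (2 * \<rho> + L)) *\<^sub>R (L *\<^sub>R V l - grad F (V l) - \<rho> *\<^sub>R \<Gamma> l)"

lemma L\<^sub>f_nonneg: "0 \<le> L\<^sub>f"
  using smooth lipschitz_on_nonneg by blast

lemma scale_pos: "0 < 2 * \<rho> + L"
  using L\<^sub>f_nonneg L \<rho> by simp

lemma V_0: "V 0 = V0"
  using iter by (simp add: inner_iterates_def)

lemma V_Suc: "V (Suc l) \<in> proj_set unit_columns (W l)"
  using iter by (simp add: inner_iterates_def)

lemma \<Gamma>_subgradient: "\<Gamma> l \<in> limiting_subdiff psi_tilde (V l)"
  using iter by (simp add: inner_iterates_def)

lemma V_feasible: "V l \<in> unit_columns"
  by (cases l) (use V0 V_0 V_Suc in \<open>auto simp: proj_set_def\<close>)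

lemma V_hull: "V l \<in> convex hull unit_columns"
  using V_feasible by (rule hull_inc)

lemma continuous_on_F: "continuous_on unit_columns F"
  using diff hull_inc
  by (metis continuous_at_imp_continuous_on differentiable_imp_continuous_within)

text \<open>Rescaling \<open>W l - V (Suc l)\<close> by \<open>2 * \<rho> + L\<close> gives a normal
  vector that cancels the \<open>\<Gamma>\<close> term and the \<open>2 * \<rho>\<close> term of the
  residual. What remains is a gradient difference and \<open>L\<close> times the step, whence the
  constant.\<close>

lemma residual_le: "residual F \<rho> (V (Suc l)) (\<Gamma> l) \<le> (L + L\<^sub>f) * norm (V (Suc l) - V l)"
proof -
  define \<nu> where "\<nu> = (2 * \<rho> + L) *\<^sub>R (W l - V (Suc l))"
  have \<nu>: "\<nu> \<in> limiting_normal_cone unit_columns (V (Suc l))"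
    unfolding \<nu>_def using V_Suc scale_pos by (intro proj_set_normal) auto
  let ?z = "grad F (V (Suc l)) + (2 * \<rho>) *\<^sub>R V (Suc l) + \<rho> *\<^sub>R \<Gamma> l + \<nu>"
  have "\<nu> = (L *\<^sub>R V l - grad F (V l) - \<rho> *\<^sub>R \<Gamma> l) - (2 * \<rho> + L) *\<^sub>R V (Suc l)"
    unfolding \<nu>_def scaleR_diff_right[of "2 * \<rho> + L" "W l"] using scale_pos by simp
  then have "?z = (grad F (V (Suc l)) - grad F (V l)) - L *\<^sub>R (V (Suc l) - V l)"
    by (simp add: algebra_simps)
  then have "norm ?z \<le> norm (grad F (V (Suc l)) - grad F (V l)) + norm (L *\<^sub>R (V (Suc l) - V l))"
    by (metis norm_triangle_ineq4)
  also have "norm (grad F (V (Suc l)) - grad F (V l)) \<le> L\<^sub>f * norm (V (Suc l) - V l)"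
    using lipschitz_onD[OF smooth V_hull V_hull] by (simp add: dist_norm)
  also have "norm (L *\<^sub>R (V (Suc l) - V l)) = L * norm (V (Suc l) - V l)"
    using L L\<^sub>f_nonneg by simp
  finally have "norm ?z \<le> (L + L\<^sub>f) * norm (V (Suc l) - V l)"
    unfolding distrib_right by linarith
  moreover have "residual F \<rho> (V (Suc l)) (\<Gamma> l) \<le> dist 0 ?z"
    unfolding residual_def by (rule infdist_le, rule image_eqI[OF _ \<nu>]) simp
  ultimately show ?thesis by simp
qed

text \<open>Sum of three inequalities: the descent lemma for \<open>F\<close>, the supergradient
  inequality for \<open>psi_tilde\<close>, and optimality of the projection tested against the old
  iterate.\<close>

lemma sufficient_decrease:
  "penalized F \<rho> (V (Suc l)) \<le> penalized F \<rho> (V l) - (L - L\<^sub>f) / 2 * (norm (V (Suc l) - V l))\<^sup>2"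
proof -
  let ?X = "V l" and ?Y = "V (Suc l)"
  have nrm: "?Y \<bullet> ?Y = ?X \<bullet> ?X"
    using norm_sq_unit_columns[OF V_feasible] by (simp flip: power2_norm_eq_inner)
  have F: "F ?Y \<le> F ?X + grad F ?X \<bullet> (?Y - ?X) + L\<^sub>f / 2 * (norm (?Y - ?X))\<^sup>2"
    by (rule descent_lemma[OF convex_convex_hull diff smooth V_hull V_hull])
  have psi: "psi_tilde ?Y \<le> psi_tilde ?X + \<Gamma> l \<bullet> (?Y - ?X)"
    by (rule limiting_subdiff_concave[OF concave_psi_tilde \<Gamma>_subgradient])
  have "(dist (W l) ?Y)\<^sup>2 \<le> (dist (W l) ?X)\<^sup>2"
    using V_Suc V_feasible by (intro power_mono) (auto simp: proj_set_def)
  \<comment> \<open>Both iterates have equal norm, so comparing distances to \<open>W l\<close>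
    reduces to comparing inner products with it.\<close>
  then have "0 \<le> W l \<bullet> (?Y - ?X)"
    unfolding dist_norm power2_norm_eq_inner inner_diff_left inner_diff_right nrm
    by (simp add: inner_commute)
  then have "0 \<le> (L *\<^sub>R ?X - grad F ?X - \<rho> *\<^sub>R \<Gamma> l) \<bullet> (?Y - ?X)"
    using scale_pos by (simp add: zero_le_divide_iff)
  then have opt: "grad F ?X \<bullet> (?Y - ?X) + \<rho> * (\<Gamma> l \<bullet> (?Y - ?X)) \<le> L * (?X \<bullet> (?Y - ?X))"
    by (simp add: inner_diff_left)
  \<comment> \<open>On a sphere the inner product of a point with a chord leaving it is minus half
    the squared chord length; this is the source of the \<open>L / 2\<close> decrease.\<close>
  have half: "?X \<bullet> (?Y - ?X) = - ((norm (?Y - ?X))\<^sup>2 / 2)"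
    unfolding power2_norm_eq_inner inner_diff_left inner_diff_right nrm
    by (simp add: inner_commute field_simps)
  have "\<rho> * psi_tilde ?Y \<le> \<rho> * psi_tilde ?X + \<rho> * (\<Gamma> l \<bullet> (?Y - ?X))"
    using mult_left_mono[OF psi, of \<rho>] \<rho> by (simp add: distrib_left)
  then show ?thesis
    using F opt unfolding half penalized_def power2_norm_eq_inner[of ?Y] power2_norm_eq_inner[of ?X] nrm
    by (simp add: algebra_simps diff_divide_distrib)
qed

lemma sum_steps_le:
  "(L - L\<^sub>f) / 2 * (\<Sum>l<T. (norm (V (Suc l) - V l))\<^sup>2) \<le> penalized F \<rho> V0 - penalized F \<rho> (V T)"
proof (induction T)
  case (Suc T)
  then show ?case using sufficient_decrease[of T] unfolding sum.lessThan_Suc distrib_left by linarith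
qed (simp add: V_0)

section \<open>Rates and iteration counts from a bound on the total decrease\<close>

context
  fixes gap :: real
  assumes gap: "\<And>T. penalized F \<rho> V0 - penalized F \<rho> (V T) \<le> gap"
begin

text \<open>Averaging: if all of the first \<open>T\<close> steps exceeded this bound, the
  telescoped decrease would exceed \<open>gap\<close>.\<close>

lemma ex_small_step:
  assumes "T \<ge> 1"
  shows "\<exists>l<T. (norm (V (Suc l) - V l))\<^sup>2 \<le> 2 * gap / ((L - L\<^sub>f) * real T)"
proof (rule ccontr)
  assume "\<not> ?thesis"
  then have "(\<Sum>l<T. 2 * gap / ((L - L\<^sub>f) * real T)) < (\<Sum>l<T. (norm (V (Suc l) - V l))\<^sup>2)"
    using assms by (intro sum_strict_mono) (auto simp: not_le lessThan_empty_iff)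
  then have "2 * gap / (L - L\<^sub>f) < (\<Sum>l<T. (norm (V (Suc l) - V l))\<^sup>2)"
    using assms by simp
  then have "gap < (L - L\<^sub>f) / 2 * (\<Sum>l<T. (norm (V (Suc l) - V l))\<^sup>2)"
    using L by (simp add: field_simps)
  with sum_steps_le[of T] gap[of T] show False by simp
qed

lemma gap_nonneg: "0 \<le> gap"
  using gap[of 0] by (simp add: V_0)

lemma Min_residual_le:
  assumes C: "C > 0" "\<And>l. residual F \<rho> (V (Suc l)) (\<Gamma> l) \<le> C * norm (V (Suc l) - V l)"
    and T: "T \<ge> 1"
  shows "(MIN l\<in>{..<T}. residual F \<rho> (V (Suc l)) (\<Gamma> l)) \<le> C / sqrt (real T) * sqrt (2 * gap / (L - L\<^sub>f))"
proof -
  obtain l where l: "l < T" "(norm (V (Suc l) - V l))\<^sup>2 \<le> 2 * gap / ((L - L\<^sub>f) * real T)"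
    using ex_small_step[OF T] by blast
  have "(MIN l\<in>{..<T}. residual F \<rho> (V (Suc l)) (\<Gamma> l)) \<le> residual F \<rho> (V (Suc l)) (\<Gamma> l)"
    using l(1) by (intro Min_le) auto
  also have "\<dots> \<le> C * norm (V (Suc l) - V l)" by (rule C)
  also have "\<dots> \<le> C * sqrt (2 * gap / ((L - L\<^sub>f) * real T))"
    using C(1) real_le_rsqrt[OF l(2)] by simp
  also have "\<dots> = C / sqrt (real T) * sqrt (2 * gap / (L - L\<^sub>f))"
    by (simp add: real_sqrt_divide real_sqrt_mult)
  finally show ?thesis .
qed

text \<open>The threshold on \<open>T\<close> forces \<open>C\<close> times some step below
  \<open>\<epsilon>\<close>. The witness for stationarity is \<open>U = V l\<close>, and
  \<open>C \<ge> 1\<close> turns that bound into closeness of \<open>U\<close>. When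
  \<open>gap = 0\<close> the ceiling is 0, and \<open>T \<ge> 1\<close> still provides an
  index.\<close>

lemma ex_eps_stationary:
  assumes C: "C > 0" "\<And>l. residual F \<rho> (V (Suc l)) (\<Gamma> l) \<le> C * norm (V (Suc l) - V l)"
    and \<epsilon>: "\<epsilon> > 0" and T: "T \<ge> 1" "int T \<ge> \<lceil>2 * C\<^sup>2 / (L - L\<^sub>f) * (gap / \<epsilon>\<^sup>2)\<rceil>"
  shows "\<exists>l<T. residual F \<rho> (V (Suc l)) (\<Gamma> l) \<le> \<epsilon> \<and> (C \<ge> 1 \<longrightarrow> eps_stationary F \<rho> \<epsilon> (V (Suc l)))"
proof -
  obtain l where l: "l < T" "(norm (V (Suc l) - V l))\<^sup>2 \<le> 2 * gap / ((L - L\<^sub>f) * real T)"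
    using ex_small_step[OF T(1)] by blast
  let ?d = "norm (V (Suc l) - V l)"
  have "2 * C\<^sup>2 / (L - L\<^sub>f) * (gap / \<epsilon>\<^sup>2) \<le> real T" using T(2) by (simp add: ceiling_le_iff)
  then have "C\<^sup>2 * (2 * gap / ((L - L\<^sub>f) * real T)) \<le> \<epsilon>\<^sup>2"
    using \<epsilon> T(1) L by (simp add: field_simps)
  moreover have "C\<^sup>2 * ?d\<^sup>2 \<le> C\<^sup>2 * (2 * gap / ((L - L\<^sub>f) * real T))"
    using l(2) by (rule mult_left_mono) simp
  ultimately have "(C * ?d)\<^sup>2 \<le> \<epsilon>\<^sup>2" by (simp add: power_mult_distrib)
  then have Cd: "C * ?d \<le> \<epsilon>" by (rule power2_le_imp_le) (use \<epsilon> in simp)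
  with C(2)[of l] have res: "residual F \<rho> (V (Suc l)) (\<Gamma> l) \<le> \<epsilon>" by linarith
  have "eps_stationary F \<rho> \<epsilon> (V (Suc l))" if "C \<ge> 1"
  proof -
    have "1 * ?d \<le> C * ?d" using that by (rule mult_right_mono) simp
    then have "norm (V l - V (Suc l)) \<le> \<epsilon>"
      unfolding norm_minus_commute[of "V l" "V (Suc l)"] using Cd by linarith
    then show ?thesis
      unfolding eps_stationary_def using V_feasible \<Gamma>_subgradient res by blast
  qed
  then show ?thesis using l(1) res by blast
qed

lemma eps_stationary_complexity:
  "\<exists>N :: real \<Rightarrow> nat. (\<forall>\<epsilon>>0. \<exists>l<N \<epsilon>. eps_stationary F \<rho> \<epsilon> (V (Suc l))) \<and>
    (\<lambda>\<epsilon>. real (N \<epsilon>)) \<in> O[at_right 0](\<lambda>\<epsilon>. 1 / \<epsilon>\<^sup>2)"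
proof -
  \<comment> \<open>The added 1 ensures \<open>C \<ge> 1\<close> and keeps \<open>C\<close> a valid
    residual constant.\<close>
  define C where "C = L + L\<^sub>f + 1"
  have C: "C \<ge> 1" "residual F \<rho> (V (Suc l)) (\<Gamma> l) \<le> C * norm (V (Suc l) - V l)" for l
  proof -
    show "C \<ge> 1" using L\<^sub>f_nonneg L by (simp add: C_def)
    show "residual F \<rho> (V (Suc l)) (\<Gamma> l) \<le> C * norm (V (Suc l) - V l)"
      unfolding C_def distrib_right[of "L + L\<^sub>f"]
      using residual_le[of l] norm_ge_zero[of "V (Suc l) - V l"] by linarith
  qed
  define K where "K = 2 * C\<^sup>2 / (L - L\<^sub>f) * gap"
  have K0: "K \<ge> 0" using L gap_nonneg by (simp add: K_def)
  \<comment> \<open>Adding 1 keeps the count positive when \<open>K = 0\<close>.\<close>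
  define N where "N \<epsilon> = nat \<lceil>K / \<epsilon>\<^sup>2\<rceil> + 1" for \<epsilon> :: real
  have "\<exists>l<N \<epsilon>. eps_stationary F \<rho> \<epsilon> (V (Suc l))" if "\<epsilon> > 0" for \<epsilon>
  proof -
    have "\<lceil>2 * C\<^sup>2 / (L - L\<^sub>f) * (gap / \<epsilon>\<^sup>2)\<rceil> = \<lceil>K / \<epsilon>\<^sup>2\<rceil>" by (simp add: K_def)
    also have "\<dots> \<le> int (N \<epsilon>)" by (simp add: N_def)
    finally show ?thesis using ex_eps_stationary[OF _ C(2) that, of "N \<epsilon>"] C(1) by (auto simp: N_def)
  qed
  moreover have "(\<lambda>\<epsilon>. real (N \<epsilon>)) \<in> O[at_right 0](\<lambda>\<epsilon>. 1 / \<epsilon>\<^sup>2)"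
  proof (rule bigoI)
    \<comment> \<open>Rounding up and the added 1 cost at most 2, which is absorbed into
      \<open>2 / \<epsilon>\<^sup>2\<close> for \<open>\<epsilon> < 1\<close>.\<close>
    have "norm (real (N \<epsilon>)) \<le> (K + 2) * norm (1 / \<epsilon>\<^sup>2)" if e: "\<epsilon> > 0" "\<epsilon> < 1" for \<epsilon> :: real
    proof -
      have "\<epsilon>\<^sup>2 \<le> 1" using e by (simp add: power_le_one)
      then have "2 \<le> 2 / \<epsilon>\<^sup>2" using e by (simp add: field_simps)
      moreover have "real (N \<epsilon>) \<le> K / \<epsilon>\<^sup>2 + 2"
      proof -
        have "0 \<le> K / \<epsilon>\<^sup>2" using K0 by simp
        then have "0 \<le> \<lceil>K / \<epsilon>\<^sup>2\<rceil>" unfolding zero_le_ceiling by linarith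
        then have "real (N \<epsilon>) = of_int \<lceil>K / \<epsilon>\<^sup>2\<rceil> + 1" by (simp add: N_def)
        then show ?thesis using ceiling_correct[of "K / \<epsilon>\<^sup>2"] by linarith
      qed
      ultimately show ?thesis by (simp add: add_divide_distrib)
    qed
    then show "\<forall>\<^sub>F \<epsilon> in at_right 0. norm (real (N \<epsilon>)) \<le> (K + 2) * norm (1 / \<epsilon>\<^sup>2)"
      unfolding eventually_at_right_field by (intro exI[of _ 1]) auto
  qed
  ultimately show ?thesis by blast
qed

text \<open>Finite termination: the stopping test succeeds at some index, since the smallest step
  tends to 0.\<close>

lemma ex_step_le:
  assumes "\<epsilon> > 0"
  shows "\<exists>l. norm (V (Suc l) - V l) \<le> \<epsilon>"
proof -
  obtain T :: nat where T: "2 * gap / ((L - L\<^sub>f) * \<epsilon>\<^sup>2) \<le> real T" using real_arch_simple by blast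
  obtain l where "(norm (V (Suc l) - V l))\<^sup>2 \<le> 2 * gap / ((L - L\<^sub>f) * real (Suc T))"
    using ex_small_step[of "Suc T"] by auto
  also have "\<dots> \<le> \<epsilon>\<^sup>2"
  proof -
    have "2 * gap / ((L - L\<^sub>f) * \<epsilon>\<^sup>2) \<le> real (Suc T)" using T by simp
    then show ?thesis using L assms by (simp add: field_simps del: of_nat_Suc)
  qed
  finally show ?thesis using assms by (meson less_imp_le power2_le_imp_le)
qed

end

end

theorem theorem1:
  fixes A :: "real^'n^'r" and b :: "real^'r" and f :: "real^'r \<Rightarrow> real"
    and \<delta> \<rho> \<rho>\<^sub>k L L\<^sub>f :: real
    and F :: "real^('n option)^'m \<Rightarrow> real"
    and V\<^sub>k :: "real^('n option)^'m"
    and V \<Gamma> :: "nat \<Rightarrow> real^('n option)^'m"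
  assumes m: "2 \<le> CARD('m)" "CARD('m) \<le> CARD('n) + 1"
    and \<delta>: "\<delta> > 0"
    and f: "\<forall>x. \<exists>e>0. \<exists>K. K-lipschitz_on (ball x e) f"
    and F: "F = f_tilde A b \<delta> f"
    and F_diff: "\<forall>U \<in> convex hull unit_columns. F differentiable (at U)"
    and F_smooth: "L\<^sub>f-lipschitz_on (convex hull unit_columns) (grad F)"
    and L: "L > L\<^sub>f"
    and \<rho>: "0 < \<rho>" "\<rho> \<le> \<rho>\<^sub>k"
    and V\<^sub>k: "V\<^sub>k \<in> unit_columns"
    and iter: "inner_iterates F \<rho>\<^sub>k L V\<^sub>k V \<Gamma>"
  shows
    "(\<forall>l. residual F \<rho>\<^sub>k (V (Suc l)) (\<Gamma> l) \<le> (L + L\<^sub>f) * norm (V (Suc l) - V l)) \<and>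
     (\<forall>C>0. (\<forall>l. residual F \<rho>\<^sub>k (V (Suc l)) (\<Gamma> l) \<le> C * norm (V (Suc l) - V l)) \<longrightarrow>
        (\<forall>T::nat\<ge>1. (MIN l\<in>{..<T}. residual F \<rho>\<^sub>k (V (Suc l)) (\<Gamma> l))
            \<le> C / sqrt (real T) *
               sqrt (2 * (penalized F \<rho>\<^sub>k V\<^sub>k - (INF U\<in>unit_columns. penalized F \<rho> U)) / (L - L\<^sub>f))) \<and>
        (\<forall>\<epsilon>>0. \<forall>T\<ge>1.
            int T \<ge> \<lceil>2 * C\<^sup>2 / (L - L\<^sub>f) *
               ((penalized F \<rho>\<^sub>k V\<^sub>k - (INF U\<in>unit_columns. penalized F \<rho> U)) / \<epsilon>\<^sup>2)\<rceil> \<longrightarrow>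
            (\<exists>l<T. residual F \<rho>\<^sub>k (V (Suc l)) (\<Gamma> l) \<le> \<epsilon> \<and>
                  (C \<ge> 1 \<longrightarrow> eps_stationary F \<rho>\<^sub>k \<epsilon> (V (Suc l)))))) \<and>
     (\<exists>N :: real \<Rightarrow> nat.
        (\<forall>\<epsilon>>0. \<exists>l<N \<epsilon>. eps_stationary F \<rho>\<^sub>k \<epsilon> (V (Suc l))) \<and>
        (\<lambda>\<epsilon>. real (N \<epsilon>)) \<in> O[at_right 0](\<lambda>\<epsilon>. 1 / \<epsilon>\<^sup>2)) \<and>
     (\<forall>\<epsilon>\<^sub>v>0. \<exists>l. norm (V (Suc l) - V l) \<le> \<epsilon>\<^sub>v)"
proof -
  have \<rho>\<^sub>k: "0 < \<rho>\<^sub>k" using \<rho> by simp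
  interpret run: inner_run F \<rho>\<^sub>k L L\<^sub>f V\<^sub>k V \<Gamma>
    by unfold_locales (use F_diff F_smooth L \<rho>\<^sub>k V\<^sub>k iter in auto)
  \<comment> \<open>The total decrease at \<open>\<rho>\<^sub>k\<close> is bounded through the
    optimal value at the possibly smaller \<open>\<rho>\<close>.\<close>
  have gap: "penalized F \<rho>\<^sub>k V\<^sub>k - penalized F \<rho>\<^sub>k (V T)
      \<le> penalized F \<rho>\<^sub>k V\<^sub>k - (INF U\<in>unit_columns. penalized F \<rho> U)" for T
    using INF_penalized_le[OF run.continuous_on_F _ \<rho>(2) run.V_feasible[of T]] \<rho>(1) by simp
  show ?thesis
    using run.residual_le run.Min_residual_le[OF gap] run.ex_eps_stationary[OF gap]
      run.eps_stationary_complexity[OF gap] run.ex_step_le[OF gap]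
    by (intro conjI allI impI) auto
qed

end
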